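(* The following hold. 1. $\mathcal{T}_0 = \{x \in \mathcal{P} \mid x \in L(x^{\sqrt{2q}})\}$, that is, $\mathcal{T}_0$ is the set of absolute points of the polarity $\pi_0$. 2. $\mathcal{T}_1 = \{x \in \mathcal{P} \mid x \in L(x^{q^2\sqrt{2q}})\}$, that is, $\mathcal{T}_1$ is the set of absolute points of the polarity $\pi_1$. In particular, each $\mathcal{T}_i$ is a Suzuki–Tits ovoid: a set of $q^2+1$ points of $\mathcal{P}$ meeting every line of the cyclic presentation of $PG(3,q)$ in at most two points.
   Context: Let $q = 2^m$ with $m \ge 3$ odd, so that $\sqrt{2q} = 2^{(m+1)/2}$ is an integer. Let $E = \mathbb{F}_{q^4} \supset K = \mathbb{F}_{q^2}$, and define $\mathcal{P} = \{x \in E \mid x^{q^3+q^2+q+1} = 1\}$ and $S = \{x \in K \mid x^{q+1} = 1\}$. Put $s = q - \sqrt{2q} + 1$ and $t = q + \sqrt{2q} + 1$, and let $\mathcal{O}_s = \{x \in E \mid x^s = 1\}$ and $\mathcal{O}_t = \{x \in E \mid x^t = 1\}$. Define $$\mathcal{T}_0 = \mathcal{O}_s \cup \left\{\left(v^{q-1} + v^{-(q-1)}\right)^{q-1} uv \;\middle|\; u \in \mathcal{O}_s,\ v \in \mathcal{O}_t \setminus \{1\}\right\},$$ $$\mathcal{T}_1 = \mathcal{O}_t \cup \left\{\left(u^{q-1} + u^{-(q-1)}\right)^{q-1} uv \;\middle|\; u \in \mathcal{O}_s \setminus \{1\},\ v \in \mathcal{O}_t\right\}.$$ Cyclic presentation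 of $PG(3,q)$: the point set is $\mathcal{P}$. The lines are the zero sets in $\mathcal{P}$ of $X^{q+1} + \alpha X + \beta$, where $\beta \in \mathcal{P}$ and $\alpha \in E$ satisfy $\alpha^{q+1} = \beta^q + \beta^{q^2+q+1}$. Generalized quadrangle $W(q)$: its points are those of $\mathcal{P}$, and its lines are the sets $$L(\beta) = \{x \in \mathcal{P} \mid x^{q+1} + (\beta^{(q^2+q+2)/2} + \beta^{(q+1)/2})x + \beta = 0\}, \qquad \beta \in \mathcal{P}.$$ Polarities: $\pi_0$ maps each point $x$ to the line $L(x^{\sqrt{2q}})$ and each line $L(x)$ to the point $x^{1/\sqrt{2q}}$. $\pi_1$ maps each point $x$ to the line $L(x^{q^2\sqrt{2q}})$ and each line $L(x)$ to the point $x^{q^2/\sqrt{2q}}$. Both are polarities of $W(q)$ (a result of Glauberman). A point $x$ is absolute for $\pi_i$ if $x \in \pi_i(x)$. *)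

theory Defs
  imports Main
begin

text \<open>The field E = F_{q^4} is modelled as an arbitrary finite field type 'a with
  CARD('a) = q^4 (all such fields are isomorphic). Throughout, q = 2^m.\<close>

definition qq :: "nat \<Rightarrow> nat" where "qq m = 2 ^ m"

text \<open>sqrt(2q) = 2^((m+1)/2) for odd m.\<close>
definition sq2q :: "nat \<Rightarrow> nat" where "sq2q m = 2 ^ ((m + 1) div 2)"

definition s_exp :: "nat \<Rightarrow> nat" where "s_exp m = qq m - sq2q m + 1"
definition t_exp :: "nat \<Rightarrow> nat" where "t_exp m = qq m + sq2q m + 1"

definition Pts :: "nat \<Rightarrow> 'a::field set" where
  "Pts m = {x. x ^ (qq m ^ 3 + qq m ^ 2 + qq m + 1) = 1}"

definition Os :: "nat \<Rightarrow> 'a::field set" where "Os m = {x. x ^ s_exp m = 1}"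
definition Ot :: "nat \<Rightarrow> 'a::field set" where "Ot m = {x. x ^ t_exp m = 1}"

definition T0 :: "nat \<Rightarrow> 'a::field set" where
  "T0 m = Os m \<union> {(v ^ (qq m - 1) + inverse (v ^ (qq m - 1))) ^ (qq m - 1) * u * v
                   | u v. u \<in> Os m \<and> v \<in> Ot m - {1}}"

definition T1 :: "nat \<Rightarrow> 'a::field set" where
  "T1 m = Ot m \<union> {(u ^ (qq m - 1) + inverse (u ^ (qq m - 1))) ^ (qq m - 1) * u * v
                   | u v. u \<in> Os m - {1} \<and> v \<in> Ot m}"

text \<open>Square root in characteristic 2 (squaring is a bijection of E); used to
  interpret the half-integral exponent beta^((q+1)/2) as (beta^(q+1))^(1/2).\<close>
definition sqrt2 :: "'a::field \<Rightarrow> 'a" where "sqrt2 x = (THE y. y ^ 2 = x)"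

definition Lw :: "nat \<Rightarrow> 'a::field \<Rightarrow> 'a set" where
  "Lw m \<beta> = {x \<in> Pts m. x ^ (qq m + 1)
      + (\<beta> ^ ((qq m ^ 2 + qq m + 2) div 2) + sqrt2 (\<beta> ^ (qq m + 1))) * x + \<beta> = 0}"

definition PG_lines :: "nat \<Rightarrow> 'a::field set set" where
  "PG_lines m = {{x \<in> Pts m. x ^ (qq m + 1) + \<alpha> * x + \<beta> = 0} | \<alpha> \<beta>.
      \<beta> \<in> Pts m \<and> \<alpha> ^ (qq m + 1) = \<beta> ^ qq m + \<beta> ^ (qq m ^ 2 + qq m + 1)}"

end

theory Submission
  imports Defs "HOL-Computational_Algebra.Polynomial"
begin

text \<open>Write \<open>F x = x\<^bsup>q\<^esup>\<close> and let \<open>\<phi>\<close> be the automorphism \<open>x \<mapsto> x\<^bsup>k\<^esup>\<close> with \<open>k\<close> equal to the square root \<open>r\<close> of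
  \<open>2q\<close> or to \<open>q\<^sup>2 r\<close>. Both polarities send \<open>x\<close> to \<open>L(\<phi> x)\<close>, and \<open>\<phi> (\<phi> x) = (F x)\<^sup>2\<close> is all that
  distinguishes \<open>\<phi>\<close> from other automorphisms.

  Every \<open>x \<in> P\<close> is a product \<open>a u v\<close> with \<open>a\<^bsup>q+1\<^esup> = 1\<close>, \<open>u \<in> O\<^sub>s\<close>, \<open>v \<in> O\<^sub>t\<close> (the two swapped for the second
  polarity). The condition \<open>x \<in> L(\<phi> x)\<close> does not involve \<open>u\<close>, and adding to it its image under \<open>F\<^sup>2\<close>,
  which inverts \<open>v\<close> and fixes \<open>a\<close>, determines \<open>\<phi> a\<close> and hence \<open>a\<close> from \<open>v\<close>. This gives the
  parametrization and the number \<open>q\<^sup>2 + 1\<close> of absolute points.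

  No two absolute points are perpendicular for the symplectic form, and a non-absolute point is
  perpendicular to at most \<open>q + 1\<close> absolute points. For a line through two absolute points, count the
  pairs of an absolute point and a point of the polar line perpendicular to it: a point of the line
  is perpendicular to all \<open>q + 1\<close> points of the polar line, any other point to at least one. So at most
  two of the \<open>q\<^sup>2 + 1\<close> absolute points lie on the line.\<close>

section \<open>Torsion in finite fields\<close>

text \<open>Bezout gives \<open>m * i = n * j + 1\<close>, so \<open>x\<close> is the product of
  \<open>x ^ (m * i)\<close>, killed by \<open>n\<close>, and the inverse of
  \<open>x ^ (n * j)\<close>, killed by \<open>m\<close>.\<close>

lemma torsion_decompose:
  fixes x :: "'a::field"
  assumes "x ^ (m * n) = 1" "coprime m n" "m > 0" "n > 0"
  obtains y z where "y ^ m = 1" "z ^ n = 1" "x = y * z"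
proof -
  obtain i j where ij: "m * i = n * j + 1"
    using bezout_nat[of m n] assms(2,3) by auto
  have x: "x \<noteq> 0"
    using assms by (metis mult_pos_pos power_0_left neq0_conv zero_neq_one)
  have "(x ^ (m * i)) ^ n = (x ^ (m * n)) ^ i" "(x ^ (n * j)) ^ m = (x ^ (m * n)) ^ j"
    by (simp_all add: mult_ac flip: power_mult)
  then have "(x ^ (m * i)) ^ n = 1" "inverse (x ^ (n * j)) ^ m = 1"
    by (simp_all add: assms(1) power_inverse)
  moreover have "x = inverse (x ^ (n * j)) * x ^ (m * i)"
    unfolding ij using x by simp
  ultimately show thesis
    using that by blast
qed

lemma torsion_trivial:
  fixes x :: "'a::field"
  assumes "x ^ m = 1" "x ^ n = 1" "coprime m n" "m > 0"
  shows "x = 1"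
proof -
  obtain i j where ij: "m * i = n * j + 1"
    using bezout_nat[of m n] assms(3,4) by auto
  have "x ^ (m * i) = 1" "x ^ (n * j) = 1"
    by (simp_all add: assms(1,2) power_mult)
  then show ?thesis
    unfolding ij by simp
qed

lemma torsion_product_unique:
  fixes y z :: "'a::field"
  assumes "y ^ m = 1" "y' ^ m = 1" "z ^ n = 1" "z' ^ n = 1" "coprime m n" "m > 0" "n > 0"
    and "y * z = y' * z'"
  shows "y = y'" "z = z'"
proof -
  have nz: "y' \<noteq> 0" "z \<noteq> 0"
    using assms by (auto simp: power_0_left)
  then have "y / y' = z' / z"
    using assms(8) by (simp add: field_simps)
  moreover have "(y / y') ^ m = 1" "(z' / z) ^ n = 1"
    using assms by (simp_all add: power_divide)
  ultimately have "y / y' = 1" "z' / z = 1"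
    using torsion_trivial[of "y / y'" m n] assms by auto
  then show "y = y'" "z = z'"
    using nz by auto
qed

text \<open>Multiplication by \<open>x\<close> permutes the nonzero elements, so it does not change
  their product.\<close>

lemma power_card_minus_1_eq_1:
  fixes x :: "'a::{finite,field}"
  assumes "x \<noteq> 0"
  shows "x ^ (card (UNIV :: 'a set) - 1) = 1"
proof -
  have "\<Prod>(UNIV - {0}) = (\<Prod>y\<in>UNIV - {0}. x * y)"
    by (rule prod.reindex_bij_witness[of _ "\<lambda>y. x * y" "\<lambda>y. y / x"]) (use assms in auto)
  also have "\<dots> = x ^ (card (UNIV :: 'a set) - 1) * \<Prod>(UNIV - {0})"
    by (simp add: prod.distrib)
  finally show ?thesis
    by simp
qed

text \<open>If the number of nonzero elements is \<open>d * k\<close>, they are the roots of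
  \<open>X ^ d - 1\<close> times a polynomial of degree at most \<open>d * (k - 1)\<close>. This
  leaves at least \<open>d\<close> roots to the first factor.\<close>

lemma card_torsion:
  assumes "d dvd card (UNIV :: 'a::{finite,field} set) - 1"
  shows "card {x :: 'a. x ^ d = 1} = d"
proof -
  define n where "n = card (UNIV :: 'a set) - 1"
  obtain k where k: "n = d * k"
    using assms by (auto simp: n_def)
  have "card {0, 1 :: 'a} \<le> card (UNIV :: 'a set)"
    by (intro card_mono) auto
  then have n: "n > 0"
    by (simp add: n_def)
  then have dk: "d > 0" "k > 0"
    by (auto simp: k)
  define p :: "'a poly" where "p = monom 1 d - 1"
  have "coeff p d = 1" and deg: "degree p \<le> d"
    using dk by (auto simp: p_def intro: degree_diff_le degree_monom_le)
  then have "p \<noteq> 0"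
    by auto
  then have "card {x. poly p x = 0} \<le> d"
    using card_poly_roots_bound deg order.trans by blast
  then have le: "card {x :: 'a. x ^ d = 1} \<le> d"
    by (simp add: p_def poly_monom)
  define r :: "'a poly" where "r = (\<Sum>i<k. monom 1 (d * i))"
  have "coeff r 0 = (\<Sum>i<k. if i = 0 then 1 else 0)"
    unfolding r_def coeff_sum using dk by (intro sum.cong) auto
  then have "r \<noteq> 0"
    using dk by auto
  moreover have "degree r \<le> d * (k - 1)"
    unfolding r_def by (intro degree_sum_le) (auto intro!: order.trans[OF degree_monom_le])
  ultimately have le': "card {x. poly r x = 0} \<le> d * (k - 1)"
    using card_poly_roots_bound[of r] by linarith
  have cover: "UNIV - {0} \<subseteq> {x :: 'a. x ^ d = 1} \<union> {x. poly r x = 0}"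
  proof
    fix x :: 'a assume "x \<in> UNIV - {0}"
    then have "x ^ n = 1"
      using power_card_minus_1_eq_1 by (simp add: n_def)
    then have "(x ^ d - 1) * (\<Sum>i<k. (x ^ d) ^ i) = 0"
      by (simp add: k power_mult flip: power_diff_1_eq)
    then show "x \<in> {x. x ^ d = 1} \<union> {x. poly r x = 0}"
      by (auto simp: r_def poly_sum poly_monom power_mult)
  qed
  have "n \<le> card ({x :: 'a. x ^ d = 1} \<union> {x. poly r x = 0})"
    using card_mono[OF _ cover] by (simp add: n_def card_Diff_singleton)
  also have "\<dots> \<le> card {x :: 'a. x ^ d = 1} + d * (k - 1)"
    using card_Un_le le' by (metis (no_types, lifting) add_left_mono order.trans)
  also have "n = d + d * (k - 1)"
    unfolding k using dk by (cases k) simp_all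
  finally show ?thesis
    using le by simp
qed

text \<open>Translation by 1 permutes the field, so adding 1 to every element leaves the sum of all
  elements unchanged.\<close>

lemma char2_of_card:
  assumes "card (UNIV :: 'a::{finite,field} set) = 2 ^ n"
  shows "(1::'a) + 1 = 0"
proof -
  have "(\<Sum>y\<in>UNIV. y) = (\<Sum>y\<in>UNIV. y + (1::'a))"
    by (rule sum.reindex_bij_witness[of _ "\<lambda>y. y + 1" "\<lambda>y. y - 1"]) auto
  also have "\<dots> = (\<Sum>y\<in>UNIV. y) + of_nat (card (UNIV :: 'a set))"
    by (simp add: sum.distrib)
  finally have "(2::'a) ^ n = 0"
    by (simp add: assms)
  then show ?thesis
    by simp
qed

lemma frobenius_add:
  assumes "(1::'a::field) + 1 = 0"
  shows "((x::'a) + y) ^ (2 ^ n) = x ^ (2 ^ n) + y ^ (2 ^ n)"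
proof (induction n)
  case (Suc n)
  have "(a + b) ^ 2 = a ^ 2 + b ^ 2" for a b :: 'a
    using assms by (simp add: power2_sum)
  then show ?case
    using Suc by (simp add: power_mult mult.commute[of 2])
qed simp

section \<open>Lines of the generalized quadrangle\<close>

text \<open>Both polarities are instances. With \<open>F\<close> and \<open>phi\<close> in place of
  explicit powers, computations become rational identities in a point and its conjugates.\<close>

locale polar_field =
  fixes q :: nat and F phi :: "'a::{finite,field} \<Rightarrow> 'a"
  assumes char2: "(1::'a) + 1 = 0"
    and card_UNIV: "card (UNIV :: 'a set) = q ^ 4"
    and q_ge_2: "q \<ge> 2"
    and F_power: "F x = x ^ q"
    and F_add: "F (x + y) = F x + F y"
    and F4: "F (F (F (F x))) = x"
    and phi_add: "phi (x + y) = phi x + phi y"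
    and phi_mult: "phi (x * y) = phi x * phi y"
    and phi_1: "phi 1 = 1"
    and phi_phi: "phi (phi x) = F x * F x"
    and phi_F: "phi (F x) = F (phi x)"
begin

lemma F_mult: "F (x * y) = F x * F y"
  by (simp add: F_power power_mult_distrib)

lemma F_1 [simp]: "F 1 = 1"
  by (simp add: F_power)

lemma F_0 [simp]: "F 0 = 0"
  using q_ge_2 by (simp add: F_power)

lemma F_divide: "F (x / y) = F x / F y"
  by (simp add: F_power power_divide)

lemma add_self: "x + x = (0::'a)"
  using char2 by (metis distrib_left mult.right_neutral mult_zero_right)

lemma add_self_left: "x + (x + y) = (y::'a)"
  by (simp add: add_self flip: add.assoc)

lemma add_eq_0: "x + y = 0 \<longleftrightarrow> x = (y::'a)"
  by (metis add_self add_self_left add.right_neutral)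

lemma uminus_eq: "- x = (x::'a)"
  by (metis add_eq_0 add.right_inverse)

lemmas char2_simps = algebra_simps add_self add_self_left

lemma square_inject: "x * x = y * y \<longleftrightarrow> x = (y::'a)"
  by (metis square_eq_iff uminus_eq)

lemma F_inject: "F x = F y \<longleftrightarrow> x = y"
  by (metis F4)

lemma phi_inject: "phi x = phi y \<longleftrightarrow> x = y"
  by (metis F_inject phi_phi square_inject)

lemma phi_0 [simp]: "phi 0 = 0"
  by (metis phi_add add_self)

lemma F_eq_0 [simp]: "F x = 0 \<longleftrightarrow> x = 0"
  by (metis F_0 F_inject)

lemma phi_eq_0 [simp]: "phi x = 0 \<longleftrightarrow> x = 0"
  by (metis phi_0 phi_inject)

lemma phi_inverse: "phi (inverse x) = inverse (phi x)"
  by (metis inverse_unique inverse_zero phi_0 phi_1 phi_mult right_inverse)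

lemma phi_divide: "phi (x / y) = phi x / phi y"
  by (simp add: divide_inverse phi_mult phi_inverse)

lemma sqrt_exists: "\<exists>y::'a. y * y = x"
proof -
  have "inj (\<lambda>y::'a. y * y)"
    by (auto simp: inj_def square_inject)
  then have "surj (\<lambda>y::'a. y * y)"
    by (simp add: finite_UNIV_inj_surj)
  then show ?thesis
    by (metis surjD)
qed

section \<open>Points, lines and the symplectic form\<close>

definition pts :: "'a set" where
  "pts = {x. x * F x * F (F x) * F (F (F x)) = 1}"

definition line :: "'a \<Rightarrow> 'a \<Rightarrow> 'a set" where
  "line \<alpha> \<beta> = {x \<in> pts. x * F x + \<alpha> * x + \<beta> = 0}"

text \<open>The defining equation of \<open>L(\<beta>)\<close> is squared, so that no half-integral exponents occur.\<close>

definition iso_line :: "'a \<Rightarrow> 'a set" where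
  "iso_line \<beta> = {x \<in> pts. (x * F x + \<beta>) * (x * F x + \<beta>)
     = (\<beta> * \<beta> * F \<beta> * F (F \<beta>) + \<beta> * F \<beta>) * (x * x)}"

text \<open>If \<open>x = X\<^bsup>q-1\<^esup>\<close> and \<open>y = Y\<^bsup>q-1\<^esup>\<close>, this says that the trace of \<open>X Y\<^bsup>q\<^sup>2\<^esup>\<close> to the field with
  \<open>q\<close> elements vanishes; this is the symplectic form of \<open>W(q)\<close>.\<close>

definition perp :: "'a \<Rightarrow> 'a \<Rightarrow> bool" where
  "perp x y \<longleftrightarrow> x * F x + y * F y + x * F x * F (F x) * y + x * y * F y * F (F y) = 0"

lemma pts_nonzero: "x \<in> pts \<Longrightarrow> x \<noteq> 0"
  by (auto simp: pts_def)

lemma phi_pts: "x \<in> pts \<Longrightarrow> phi x \<in> pts"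
  by (auto simp: pts_def simp flip: phi_mult phi_F) (simp add: phi_1)

lemma phi_image_pts: "phi ` pts = pts"
  by (intro endo_inj_surj) (auto simp: phi_pts inj_on_def phi_inject)

text \<open>The equation of the line and its image under \<open>F\<close> reduce
  \<open>z * F z * F (F z)\<close>, so that perpendicularity to \<open>p\<close> becomes an affine
  condition on \<open>z\<close>.\<close>

lemma perp_line_point:
  assumes "z \<in> line \<alpha> \<beta>"
  shows "perp p z \<longleftrightarrow> (p * F p + p * F \<alpha> * \<beta> + \<beta>)
           + z * (\<alpha> + p * F p * F (F p) + p * (\<alpha> * F \<alpha> + F \<beta>)) = 0"
proof -
  have z: "z * F z = \<alpha> * z + \<beta>"
    using assms by (simp add: line_def add_eq_0 add.assoc)
  have z2: "F z * F (F z) = F \<alpha> * F z + F \<beta>"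
    by (metis z F_mult F_add)
  have "z * F z * F (F z) = F \<alpha> * (z * F z) + F \<beta> * z"
    using z2 by (simp add: mult.assoc) (simp add: algebra_simps)
  then have z3: "z * F z * F (F z) = F \<alpha> * (\<alpha> * z + \<beta>) + F \<beta> * z"
    by (simp add: z)
  have p3: "p * z * F z * F (F z) = p * (F \<alpha> * (\<alpha> * z + \<beta>) + F \<beta> * z)"
    by (simp add: z3[symmetric] mult.assoc)
  have "perp p z \<longleftrightarrow> p * F p + (\<alpha> * z + \<beta>) + p * F p * F (F p) * z
     + p * (F \<alpha> * (\<alpha> * z + \<beta>) + F \<beta> * z) = 0"
    unfolding perp_def by (simp only: p3 z)
  also have "\<dots> \<longleftrightarrow> (p * F p + p * F \<alpha> * \<beta> + \<beta>)
           + z * (\<alpha> + p * F p * F (F p) + p * (\<alpha> * F \<alpha> + F \<beta>)) = 0"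
    by (rule arg_cong[where f = "\<lambda>x. x = 0"]) (simp add: char2_simps)
  finally show ?thesis .
qed

text \<open>An expression \<open>U + z * V\<close> that vanishes for two distinct \<open>z\<close>
  has \<open>U = V = 0\<close>. The equation \<open>U = 0\<close> places \<open>p\<close> on the
  polar line, whose coefficients are \<open>F \<alpha> * \<beta>\<close> and
  \<open>\<beta>\<close>.\<close>

lemma perp_two_points_line:
  assumes "x \<in> line \<alpha> \<beta>" "y \<in> line \<alpha> \<beta>" "x \<noteq> y" "perp p x" "perp p y"
  shows "p * F p + p * F \<alpha> * \<beta> + \<beta> = 0"
    and "z \<in> line \<alpha> \<beta> \<Longrightarrow> perp p z"
proof -
  let ?U = "p * F p + p * F \<alpha> * \<beta> + \<beta>"
  let ?V = "\<alpha> + p * F p * F (F p) + p * (\<alpha> * F \<alpha> + F \<beta>)"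
  have U: "?U = x * ?V" "?U = y * ?V"
    using assms(4,5) unfolding perp_line_point[OF assms(1)] perp_line_point[OF assms(2)] add_eq_0
    by blast+
  then have V: "?V = 0"
    using assms(3) by (metis mult_cancel_right)
  then show U0: "?U = 0"
    using U(1) by simp
  show "perp p z" if "z \<in> line \<alpha> \<beta>"
    unfolding perp_line_point[OF that] U0 V by simp
qed

text \<open>\<open>\<alpha>\<close> is the square root of the coefficient in
  \<open>iso_line\<close>. The equation \<open>F \<alpha> * \<beta> = \<alpha>\<close>, which rests
  on \<open>\<beta>\<close> having norm 1, says that the line is its own polar line; the second
  equation is the condition on the lines of PG(3,q).\<close>

lemma iso_line_eq_line:
  assumes "\<beta> \<in> pts"
  obtains \<alpha> where "F \<alpha> * \<beta> = \<alpha>" "\<alpha> * F \<alpha> = F \<beta> + \<beta> * F \<beta> * F (F \<beta>)" "iso_line \<beta> = line \<alpha> \<beta>"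
proof -
  obtain \<alpha> where \<alpha>: "\<alpha> * \<alpha> = \<beta> * \<beta> * F \<beta> * F (F \<beta>) + \<beta> * F \<beta>"
    using sqrt_exists by blast
  have b: "\<beta> * F \<beta> * F (F \<beta>) * F (F (F \<beta>)) = 1"
    using assms by (simp add: pts_def)
  have "F \<alpha> * F \<alpha> = F \<beta> * F \<beta> * F (F \<beta>) * F (F (F \<beta>)) + F \<beta> * F (F \<beta>)"
    using \<alpha> by (metis F_add F_mult)
  then have "(F \<alpha> * \<beta>) * (F \<alpha> * \<beta>) = \<beta> * F \<beta> * (\<beta> * F \<beta> * F (F \<beta>) * F (F (F \<beta>)))
      + \<beta> * \<beta> * F \<beta> * F (F \<beta>)"
    by (simp add: mult_ac) (simp add: algebra_simps)
  then have "(F \<alpha> * \<beta>) * (F \<alpha> * \<beta>) = \<alpha> * \<alpha>"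
    by (simp add: b \<alpha>)
  then have 1: "F \<alpha> * \<beta> = \<alpha>"
    by (simp only: square_inject)
  have "\<beta> * (\<alpha> * F \<alpha>) = \<alpha> * (F \<alpha> * \<beta>)"
    by simp
  also have "\<dots> = \<beta> * (F \<beta> + \<beta> * F \<beta> * F (F \<beta>))"
    unfolding 1 \<alpha> by (simp add: algebra_simps)
  finally have 2: "\<alpha> * F \<alpha> = F \<beta> + \<beta> * F \<beta> * F (F \<beta>)"
    using pts_nonzero[OF assms] by simp
  have "(x * F x + \<beta>) * (x * F x + \<beta>) = (\<alpha> * \<alpha>) * (x * x) \<longleftrightarrow> x * F x + \<alpha> * x + \<beta> = 0" for x
  proof -
    have "(x * F x + \<beta>) * (x * F x + \<beta>) = (\<alpha> * \<alpha>) * (x * x) \<longleftrightarrow> x * F x + \<beta> = \<alpha> * x"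
      using square_inject[of "x * F x + \<beta>" "\<alpha> * x"] by (simp add: mult_ac)
    then show ?thesis
      using add_eq_0[of "x * F x + \<beta>" "\<alpha> * x"] by (simp add: ac_simps)
  qed
  then have "iso_line \<beta> = line \<alpha> \<beta>"
    unfolding iso_line_def line_def \<alpha> by blast
  with 1 2 show thesis
    using that by blast
qed

lemma iso_line_perp:
  assumes "\<beta> \<in> pts" "x \<in> iso_line \<beta>" "y \<in> iso_line \<beta>"
  shows "perp x y"
proof -
  obtain \<alpha> where 1: "F \<alpha> * \<beta> = \<alpha>" and l: "iso_line \<beta> = line \<alpha> \<beta>"
    using iso_line_eq_line[OF assms(1)] by metis
  have x: "x * F x = \<alpha> * x + \<beta>"
    using assms(2) by (simp add: l line_def add_eq_0 add.assoc)
  have x2: "F x * F (F x) = F \<alpha> * F x + F \<beta>"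
    by (metis x F_mult F_add)
  have "x * F x * F (F x) = F \<alpha> * (x * F x) + F \<beta> * x"
    using x2 by (simp add: mult.assoc) (simp add: algebra_simps)
  then have x3: "x * F x * F (F x) = F \<alpha> * \<alpha> * x + F \<alpha> * \<beta> + F \<beta> * x"
    by (simp add: x algebra_simps)
  have 2: "x * F \<alpha> * \<beta> = \<alpha> * x"
    by (subst (2) 1[symmetric]) (simp add: mult_ac)
  have "x * F x + x * F \<alpha> * \<beta> + \<beta> = 0"
    unfolding x 2 by (simp add: char2_simps)
  moreover have "\<alpha> + x * F x * F (F x) + x * (\<alpha> * F \<alpha> + F \<beta>) = 0"
    unfolding x3 1 by (simp add: char2_simps)
  ultimately show ?thesis
    using perp_line_point[of y \<alpha> \<beta> x] assms(3) by (simp add: l)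
qed

text \<open>A point perpendicular to two points of the line is on the polar line, which is the line
  itself. Hence W(q) has no triangles.\<close>

lemma iso_line_perp_closed:
  assumes "\<beta> \<in> pts" "x \<in> iso_line \<beta>" "y \<in> iso_line \<beta>" "x \<noteq> y" "w \<in> pts" "perp w x" "perp w y"
  shows "w \<in> iso_line \<beta>"
proof -
  obtain \<alpha> where 1: "F \<alpha> * \<beta> = \<alpha>" and l: "iso_line \<beta> = line \<alpha> \<beta>"
    using iso_line_eq_line[OF assms(1)] by metis
  have "w * F w + w * F \<alpha> * \<beta> + \<beta> = 0"
    using perp_two_points_line(1) assms unfolding l by blast
  also have "w * F \<alpha> * \<beta> = \<alpha> * w"
    by (subst (2) 1[symmetric]) (simp add: mult_ac)
  finally show ?thesis
    using assms(5) by (simp add: l line_def)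
qed

lemma iso_line_unique:
  assumes "\<beta> \<in> pts" "\<gamma> \<in> pts" "x \<in> iso_line \<beta>" "y \<in> iso_line \<beta>"
    "x \<in> iso_line \<gamma>" "y \<in> iso_line \<gamma>" "x \<noteq> y"
  shows "\<beta> = \<gamma>"
proof -
  obtain a c where "iso_line \<beta> = line a \<beta>" "iso_line \<gamma> = line c \<gamma>"
    using iso_line_eq_line assms(1,2) by metis
  then have *: "x * F x = a * x + \<beta>" "y * F y = a * y + \<beta>" "x * F x = c * x + \<gamma>" "y * F y = c * y + \<gamma>"
    using assms by (auto simp: line_def add_eq_0 add.assoc)
  have "(a - c) * (x - y) = ((a * x + \<beta>) - (c * x + \<gamma>)) - ((a * y + \<beta>) - (c * y + \<gamma>))"
    by (simp add: algebra_simps)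
  also have "\<dots> = 0"
    using * by simp
  finally have "a = c"
    using assms(7) by simp
  then show ?thesis
    using * by simp
qed

lemma perp_imp_iso_line:
  assumes "x \<in> pts" "y \<in> pts" "x \<noteq> y" "perp x y"
  obtains \<beta> where "\<beta> \<in> pts" "x \<in> iso_line \<beta>" "y \<in> iso_line \<beta>"
proof -
  define x1 x2 x3 y1 y2 y3 where d: "x1 = F x" "x2 = F x1" "x3 = F x2" "y1 = F y" "y2 = F y1" "y3 = F y2"
  have Fs [simp]: "F x = x1" "F x1 = x2" "F x2 = x3" "F x3 = x" "F y = y1" "F y1 = y2" "F y2 = y3" "F y3 = y"
    by (simp_all add: d F4)
  have X: "x * x1 * x2 * x3 = 1" and Y: "y * y1 * y2 * y3 = 1"
    using assms by (simp_all add: pts_def)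
  have P: "x * x1 + y * y1 + x * x1 * x2 * y + x * y * y1 * y2 = 0"
    using assms(4) by (simp add: perp_def)
  have ne: "x + y \<noteq> 0" "x1 + y1 \<noteq> 0" "x2 + y2 \<noteq> 0" "x3 + y3 \<noteq> 0"
    using assms(3) by (simp_all add: add_eq_0 d F_inject del: Fs)
  \<comment> \<open>\<open>\<alpha>\<close> and \<open>\<beta>\<close> solve the linear system
    \<open>x * F x = \<alpha> * x + \<beta>\<close>, \<open>y * F y = \<alpha> * y + \<beta>\<close>
    by Cramer's rule in characteristic 2.\<close>
  define \<beta> where "\<beta> = x * y * (x1 + y1) / (x + y)"
  define \<alpha> where "\<alpha> = (x * x1 + y * y1) / (x + y)"
  define b1 b2 b3 where bs: "b1 = F \<beta>" "b2 = F b1" "b3 = F b2"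
  have b1: "b1 = x1 * y1 * (x2 + y2) / (x1 + y1)"
    by (simp add: bs \<beta>_def F_mult F_add F_divide)
  have b2: "b2 = x2 * y2 * (x3 + y3) / (x2 + y2)"
    by (simp add: bs(2) b1 F_mult F_add F_divide)
  have b3: "b3 = x3 * y3 * (x + y) / (x3 + y3)"
    by (simp add: bs(3) b2 F_mult F_add F_divide)
  have a1: "F \<alpha> = (x1 * x2 + y1 * y2) / (x1 + y1)"
    by (simp add: \<alpha>_def F_mult F_add F_divide)
  have "\<beta> * b1 * b2 * b3 = (x * x1 * x2 * x3) * (y * y1 * y2 * y3)"
    unfolding b1 b2 b3 \<beta>_def using ne by (simp add: mult_ac)
  then have bp: "\<beta> \<in> pts"
    unfolding pts_def X Y bs by simp
  \<comment> \<open>Here perpendicularity of \<open>x\<close> and \<open>y\<close> enters: it makes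
    the line through them its own polar line.\<close>
  have "\<beta> * F \<alpha> = x * y * (x1 * x2 + y1 * y2) / (x + y)"
    unfolding a1 \<beta>_def using ne by (simp only: times_divide_times_eq) (simp add: divide_simps)
  also have "x * y * (x1 * x2 + y1 * y2) = x * x1 + y * y1"
    by (rule add_eq_0[THEN iffD1]) (use P in \<open>simp add: algebra_simps\<close>)
  finally have A: "\<beta> * F \<alpha> = \<alpha>"
    by (simp add: \<alpha>_def)
  have "\<beta> * b1 * b2 = (x * x1 * x2) * (y * y1 * y2) * (x3 + y3) / (x + y)"
    unfolding b1 b2 \<beta>_def using ne by (simp add: mult_ac)
  also have "(x * x1 * x2) * (y * y1 * y2) * (x3 + y3)
      = (x * x1 * x2 * x3) * (y * y1 * y2) + (y * y1 * y2 * y3) * (x * x1 * x2)"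
    by (simp add: algebra_simps)
  finally have bbb: "\<beta> * b1 * b2 = (y * y1 * y2 + x * x1 * x2) / (x + y)"
    by (simp add: X Y)
  have "\<alpha> * F \<alpha> * ((x + y) * (x1 + y1)) = (x * x1 + y * y1) * (x1 * x2 + y1 * y2)"
    unfolding a1 unfolding \<alpha>_def using ne by simp
  also have "\<dots> = x1 * y1 * (x2 + y2) * (x + y)
      + (x1 + y1) * (y * y1 * y2 + x * x1 * x2)"
    by (simp add: char2_simps)
  also have "x1 * y1 * (x2 + y2) = b1 * (x1 + y1)"
    unfolding b1 using ne by simp
  also have "y * y1 * y2 + x * x1 * x2 = \<beta> * b1 * b2 * (x + y)"
    unfolding bbb using ne by simp
  also have "b1 * (x1 + y1) * (x + y) + (x1 + y1) * (\<beta> * b1 * b2 * (x + y))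
      = (b1 + \<beta> * b1 * b2) * ((x + y) * (x1 + y1))"
    by (simp add: algebra_simps)
  finally have aa: "\<alpha> * F \<alpha> = b1 + \<beta> * b1 * b2"
    using ne by simp
  have "\<alpha> * \<alpha> = \<beta> * (\<alpha> * F \<alpha>)"
    by (subst (2) A[symmetric]) (simp add: mult_ac)
  then have sq: "\<beta> * \<beta> * F \<beta> * F (F \<beta>) + \<beta> * F \<beta> = \<alpha> * \<alpha>"
    unfolding aa bs by (simp add: algebra_simps)
  have "x * F x + \<beta> = \<alpha> * x" "y * F y + \<beta> = \<alpha> * y"
    using ne(1) unfolding \<alpha>_def \<beta>_def by (simp_all add: divide_simps) (simp_all add: char2_simps)
  then have "x \<in> iso_line \<beta>" "y \<in> iso_line \<beta>"
    using assms unfolding iso_line_def sq by (simp_all add: mult_ac)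
  with bp show thesis
    using that by blast
qed

text \<open>Applying \<open>phi\<close> to the equation turns \<open>phi (phi y)\<close> into the
  square of \<open>F y\<close>; both sides are then squares, and roots can be taken. This symmetry
  is the polarity property.\<close>

lemma iso_line_phi_sym:
  assumes "x \<in> pts" "y \<in> pts" "x \<in> iso_line (phi y)"
  shows "y \<in> iso_line (phi x)"
proof -
  define y1 y2 y3 X X1 X2 where d: "y1 = F y" "y2 = F y1" "y3 = F y2" "X = phi x" "X1 = F X" "X2 = F X1"
  have [simp]: "F y = y1" "F y1 = y2" "F y2 = y3" "phi x = X" "F X = X1" "F X1 = X2"
    by (simp_all add: d)
  have Y: "y * y1 * y2 * y3 = 1" "y \<noteq> 0" "y1 \<noteq> 0"
    using assms by (auto simp add: pts_def)
  have "phi ((x * F x + phi y) * (x * F x + phi y))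
    = phi ((phi y * phi y * F (phi y) * F (F (phi y)) + phi y * F (phi y)) * (x * x))"
    using assms by (simp add: iso_line_def)
  then have "(X * X1 + y1 * y1) * (X * X1 + y1 * y1)
     = ((y1 * y1 * y2 * y3 + y1 * y2) * X) * ((y1 * y1 * y2 * y3 + y1 * y2) * X)"
    by (simp add: phi_mult phi_add phi_F phi_phi F_mult char2_simps)
  then have e: "X * X1 + y1 * y1 = (y1 * y1 * y2 * y3 + y1 * y2) * X"
    by (simp only: square_inject)
  have "y * X * X1 = y * ((X * X1 + y1 * y1) + y1 * y1)"
    by (simp add: char2_simps)
  also have "\<dots> = (y1 * (y * y1 * y2 * y3) + y * y1 * y2) * X + y * y1 * y1"
    unfolding e by (simp add: algebra_simps)
  finally have e1: "y * X * X1 = (y1 + y * y1 * y2) * X + y * y1 * y1"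
    by (simp add: Y)
  have e2: "y1 * X1 * X2 = (y2 + y1 * y2 * y3) * X1 + y1 * y2 * y2"
    using arg_cong[OF e1, of F] by (simp add: F_mult F_add)
  have "y * y1 * X1 * X2 = y * ((y2 + y1 * y2 * y3) * X1 + y1 * y2 * y2)"
    unfolding e2[symmetric] by (simp add: mult_ac)
  also have "\<dots> = (y * y2 + (y * y1 * y2 * y3)) * X1 + y * y1 * y2 * y2"
    by (simp add: algebra_simps)
  finally have e3: "y * y1 * X1 * X2 = (y * y2 + 1) * X1 + y * y1 * y2 * y2"
    by (simp add: Y)
  \<comment> \<open>The goal is multiplied by \<open>y * y1\<close>; then \<open>e3\<close> removes
    \<open>X2\<close> and \<open>e1\<close> removes \<open>X1\<close>.\<close>
  have "y * y1 * ((X * X * X1 * X2 + X * X1) * (y * y))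
      = (y * y1 * X1 * X2) * (X * X * y * y) + y * y * y1 * (y * X * X1)"
    by (simp add: algebra_simps)
  also have "\<dots> = (y * y2 + 1) * (X * y) * (y * X * X1) + y * y1 * y2 * y2 * X * X * y * y
      + y * y * y1 * (y * X * X1)"
    unfolding e3 by (simp add: algebra_simps)
  also have "\<dots> = y * y1 * ((y * y1 + X) * (y * y1 + X))"
    unfolding e1 by (simp add: char2_simps)
  finally have "(X * X * X1 * X2 + X * X1) * (y * y) = (y * y1 + X) * (y * y1 + X)"
    using Y by simp
  then show ?thesis
    using assms by (simp add: iso_line_def)
qed

section \<open>Absolute points\<close>

definition abs_pts :: "'a set" where
  "abs_pts = {x \<in> pts. x \<in> iso_line (phi x)}"

lemma abs_pts_subset: "abs_pts \<subseteq> pts"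
  by (auto simp: abs_pts_def)

lemma iso_line_subset: "iso_line \<beta> \<subseteq> pts"
  by (auto simp: iso_line_def)

text \<open>The line \<open>L(\<beta>)\<close> is the image of a point \<open>w\<close>, so \<open>w\<close> lies on the images of \<open>x\<close> and \<open>y\<close>.
  As \<open>W(q)\<close> has no triangles, \<open>w\<close> lies on \<open>L(\<beta>)\<close>, and then all three lines coincide.\<close>

lemma abs_pts_iso_line_unique:
  assumes "x \<in> abs_pts" "y \<in> abs_pts" "\<beta> \<in> pts" "x \<in> iso_line \<beta>" "y \<in> iso_line \<beta>"
  shows "x = y"
proof (rule ccontr)
  assume ne: "x \<noteq> y"
  obtain w where w: "w \<in> pts" "\<beta> = phi w"
    using assms(3) phi_image_pts by (metis imageE)
  have x: "x \<in> pts" "x \<in> iso_line (phi x)" "w \<in> iso_line (phi x)"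
    and y: "y \<in> pts" "y \<in> iso_line (phi y)" "w \<in> iso_line (phi y)"
    using assms w iso_line_phi_sym by (auto simp: abs_pts_def)
  have "perp w x" "perp w y"
    using iso_line_perp[OF phi_pts] x y by blast+
  then have wl: "w \<in> iso_line \<beta>"
    using iso_line_perp_closed[OF assms(3-5) ne w(1)] by blast
  have "w = x"
    using iso_line_unique[OF assms(3) phi_pts[OF x(1)] assms(4) wl x(2,3)] w phi_inject by metis
  moreover have "w = y"
    using iso_line_unique[OF assms(3) phi_pts[OF y(1)] assms(5) wl y(2,3)] w phi_inject by metis
  ultimately show False
    using ne by simp
qed

lemma abs_pts_perp_unique:
  assumes "x \<in> abs_pts" "y \<in> abs_pts" "perp x y"
  shows "x = y"
proof (rule ccontr)
  assume "x \<noteq> y"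
  then obtain \<beta> where "\<beta> \<in> pts" "x \<in> iso_line \<beta>" "y \<in> iso_line \<beta>"
    using assms abs_pts_subset by (elim perp_imp_iso_line[rotated 3]) auto
  then show False
    using abs_pts_iso_line_unique[OF assms(1,2)] \<open>x \<noteq> y\<close> by blast
qed

section \<open>Bounds on points of a line and on perpendicular absolute points\<close>

lemma card_quadratic_le: "card {x. x * F x + a * x + b = 0} \<le> q + 1"
proof -
  define p where "p = monom (1::'a) (q + 1) + [:b, a:]"
  have "coeff p (q + 1) = 1"
    using q_ge_2 by (auto simp: p_def coeff_pCons split: nat.split)
  moreover have deg: "degree p \<le> q + 1"
    unfolding p_def by (intro degree_add_le degree_monom_le) auto
  ultimately have "card {x. poly p x = 0} \<le> q + 1"
    using card_poly_roots_bound[of p] by fastforce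
  moreover have "poly p x = x * F x + a * x + b" for x
    by (simp add: p_def poly_monom F_power algebra_simps)
  ultimately show ?thesis
    by simp
qed

lemma card_line_le: "card (line \<alpha> \<beta>) \<le> q + 1"
  using card_quadratic_le[of \<alpha> \<beta>] card_mono[of "{x. x * F x + \<alpha> * x + \<beta> = 0}" "line \<alpha> \<beta>"]
  by (force simp: line_def)

text \<open>An absolute \<open>y\<close> perpendicular to \<open>p\<close> lies with
  \<open>p\<close> on some \<open>iso_line (phi w)\<close>, and \<open>w\<close> is on
  \<open>iso_line (phi p)\<close> by symmetry. As \<open>iso_line (phi w)\<close> has at most one
  absolute point, \<open>w\<close> determines \<open>y\<close>, and there are at most
  \<open>q + 1\<close> choices for \<open>w\<close>.\<close>

lemma card_perp_abs_pts_le: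
  assumes "p \<in> pts" "p \<notin> abs_pts"
  shows "card {y \<in> abs_pts. perp p y} \<le> q + 1"
proof -
  have "\<exists>w. w \<in> iso_line (phi p) \<and> y \<in> iso_line (phi w)" if "y \<in> {y \<in> abs_pts. perp p y}" for y
  proof -
    have y: "y \<in> pts" "p \<noteq> y" "perp p y"
      using that assms abs_pts_subset by auto
    obtain \<beta> where b: "\<beta> \<in> pts" "p \<in> iso_line \<beta>" "y \<in> iso_line \<beta>"
      using perp_imp_iso_line[OF assms(1) y] by blast
    obtain w where "w \<in> pts" "\<beta> = phi w"
      using b(1) phi_image_pts by (metis imageE)
    then show ?thesis
      using b iso_line_phi_sym assms by blast
  qed
  then obtain g where g: "g y \<in> iso_line (phi p)" "y \<in> iso_line (phi (g y))"
    if "y \<in> {y \<in> abs_pts. perp p y}" for y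
    by metis
  have "inj_on g {y \<in> abs_pts. perp p y}"
  proof (rule inj_onI)
    fix y z assume yz: "y \<in> {y \<in> abs_pts. perp p y}" "z \<in> {y \<in> abs_pts. perp p y}" "g y = g z"
    have "phi (g y) \<in> pts"
      using g(1)[OF yz(1)] iso_line_subset phi_pts by blast
    then show "y = z"
      using abs_pts_iso_line_unique g(2)[OF yz(1)] g(2)[OF yz(2)] yz by auto
  qed
  then have "card {y \<in> abs_pts. perp p y} \<le> card (iso_line (phi p))"
    using g(1) by (intro card_inj_on_le[of g]) auto
  also have "\<dots> \<le> q + 1"
    using iso_line_eq_line[OF phi_pts[OF assms(1)]] card_line_le by metis
  finally show ?thesis .
qed

section \<open>Points perpendicular to three given points\<close>

definition perp_map :: "'a \<Rightarrow> 'a \<Rightarrow> 'a" where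
  "perp_map a P = P * a * F a + F P * a * F a * F (F a) + F (F P) + F (F (F P)) * a"

lemma perp_map_add: "perp_map a (P + Q) = perp_map a P + perp_map a Q"
  by (simp add: perp_map_def F_add algebra_simps)

text \<open>Multiplying the condition for the point \<open>F P / P\<close> by \<open>P\<close> turns
  it into the vanishing of a map that is additive in \<open>P\<close>.\<close>

lemma perp_map_eq_0:
  assumes "P \<noteq> 0"
  shows "perp (F P / P) a \<longleftrightarrow> perp_map a P = 0"
proof -
  have "perp (F P / P) a \<longleftrightarrow> perp_map a P / P = 0"
    unfolding perp_def perp_map_def using assms
    by (intro arg_cong[where f = "\<lambda>x. x = 0"]) (simp add: F_divide field_simps)
  then show ?thesis
    using assms by simp
qed

text \<open>As \<open>a\<close> has norm 1, the map \<open>y \<mapsto> a * F y\<close> permutes the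
  four terms of \<open>perp_map a P\<close> cyclically.\<close>

lemma perp_map_fixed:
  assumes "a \<in> pts"
  shows "a * F (perp_map a P) = perp_map a P"
proof -
  have "a * F (perp_map a P) = F P * a * F a * F (F a)
      + F (F P) * (a * F a * F (F a) * F (F (F a))) + F (F (F P)) * a + P * a * F a"
    by (simp add: perp_map_def F_add F_mult F4 algebra_simps)
  then show ?thesis
    using assms by (simp add: pts_def perp_map_def algebra_simps)
qed

lemma card_fixed_le:
  assumes "a \<noteq> 0"
  shows "card {y. a * F y = y} \<le> q"
proof -
  define p where "p = monom a q - monom 1 1"
  have "coeff p q = a"
    using q_ge_2 by (auto simp: p_def)
  moreover have deg: "degree p \<le> q"
    unfolding p_def using q_ge_2 by (intro degree_diff_le order.trans[OF degree_monom_le]) auto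
  ultimately have "card {x. poly p x = 0} \<le> q"
    using card_poly_roots_bound[of p] assms by fastforce
  then show ?thesis
    by (simp add: p_def poly_monom F_power)
qed

text \<open>The three maps take at most \<open>q ^ 3 < q ^ 4\<close> joint values, so two distinct
  field elements agree under all of them; their sum is a nonzero common zero.\<close>

lemma exists_common_perp:
  assumes "a \<in> pts" "b \<in> pts" "c \<in> pts"
  obtains p where "p \<in> pts" "perp p a" "perp p b" "perp p c"
proof -
  define K where "K a = {y::'a. a * F y = y}" for a
  define g where "g P = (perp_map a P, perp_map b P, perp_map c P)" for P
  have "card (K a \<times> K b \<times> K c) = card (K a) * (card (K b) * card (K c))"
    by (simp add: card_cartesian_product)
  also have "\<dots> \<le> q * (q * q)"
    unfolding K_def using assms card_fixed_le pts_nonzero by (intro mult_mono) auto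
  also have "\<dots> < q ^ 4"
    using q_ge_2 by (simp add: eval_nat_numeral)
  finally have "card (K a \<times> K b \<times> K c) < card (UNIV :: 'a set)"
    by (simp add: card_UNIV)
  moreover have "range g \<subseteq> K a \<times> K b \<times> K c"
    using assms perp_map_fixed by (auto simp: g_def K_def)
  ultimately have "card (range g) < card (UNIV :: 'a set)"
    using card_mono[of "K a \<times> K b \<times> K c" "range g"] by fastforce
  then have "\<not> inj g"
    using card_image[of g UNIV] by auto
  then obtain P Q where PQ: "P \<noteq> Q" "g P = g Q"
    by (auto simp: inj_def)
  define D where "D = P + Q"
  have D: "D \<noteq> 0"
    using PQ by (simp add: D_def add_eq_0)
  have "perp_map a D = 0" "perp_map b D = 0" "perp_map c D = 0"
    using PQ(2) by (simp_all add: D_def g_def perp_map_add add_self)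
  then have "perp (F D / D) a" "perp (F D / D) b" "perp (F D / D) c"
    using D by (simp_all add: perp_map_eq_0)
  moreover have "F D / D \<in> pts"
    using D by (simp add: pts_def F_divide F4)
  ultimately show thesis
    using that by blast
qed

lemma card_abs_pts_line_le:
  assumes "card abs_pts = q ^ 2 + 1"
  shows "card (abs_pts \<inter> line \<alpha> \<beta>) \<le> 2"
proof (rule ccontr)
  define c where "c = card (abs_pts \<inter> line \<alpha> \<beta>)"
  assume "\<not> card (abs_pts \<inter> line \<alpha> \<beta>) \<le> 2"
  then have c3: "c \<ge> 3"
    by (simp add: c_def)
  then have "abs_pts \<inter> line \<alpha> \<beta> \<noteq> {}"
    unfolding c_def by (metis card.empty not_numeral_le_zero)
  then obtain a where a: "a \<in> abs_pts \<inter> line \<alpha> \<beta>"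
    by blast
  have "abs_pts \<inter> line \<alpha> \<beta> \<noteq> {a}"
    using c3 c_def by auto
  then obtain b where b: "b \<in> abs_pts \<inter> line \<alpha> \<beta>" "b \<noteq> a"
    using a by blast
  have ap: "a \<in> pts" "b \<in> pts"
    using a b abs_pts_subset by auto
  \<comment> \<open>\<open>M\<close> is the polar line. For its size only
    \<open>1 \<le> k \<le> q + 1\<close> is established, so the final estimate treats every such
    \<open>k\<close>.\<close>
  define M where "M = {p \<in> pts. perp p a \<and> perp p b}"
  define k where "k = card M"
  have M_subset: "M \<subseteq> {p. p * F p + (F \<alpha> * \<beta>) * p + \<beta> = 0}"
    using perp_two_points_line(1)[of a \<alpha> \<beta> b] a b by (auto simp: M_def mult_ac)
  have kq: "k \<le> q + 1"
    unfolding k_def using card_mono[OF _ M_subset] card_quadratic_le[of "F \<alpha> * \<beta>" \<beta>] by fastforce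
  have M_abs: "p \<notin> abs_pts" if "p \<in> M" for p
    using that a b abs_pts_perp_unique by (auto simp: M_def)
  have count1: "card {p \<in> M. perp p z} = k" if "z \<in> abs_pts \<inter> line \<alpha> \<beta>" for z
  proof -
    have "{p \<in> M. perp p z} = M"
      using perp_two_points_line(2)[of a \<alpha> \<beta> b] a b that by (auto simp: M_def)
    then show ?thesis
      by (simp add: k_def)
  qed
  have count2: "card {p \<in> M. perp p z} \<ge> 1" if "z \<in> abs_pts" for z
  proof -
    have "z \<in> pts"
      using that abs_pts_subset by blast
    then obtain p where "p \<in> {p \<in> M. perp p z}"
      using exists_common_perp[of a b z] ap unfolding M_def by blast
    then show ?thesis
      by (metis One_nat_def Suc_leI card_gt_0_iff empty_iff finite)
  qed
  have k1: "k \<ge> 1"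
    using count2[of a] count1[of a] a by simp
  have "(\<Sum>z\<in>abs_pts. card {p \<in> M. perp p z}) = (\<Sum>z\<in>abs_pts. \<Sum>p\<in>M. if perp p z then 1 else 0)"
    by (intro sum.cong refl) (simp add: sum.If_cases Int_def)
  also have "\<dots> = (\<Sum>p\<in>M. \<Sum>z\<in>abs_pts. if perp p z then 1 else 0)"
    by (rule sum.swap)
  also have "\<dots> = (\<Sum>p\<in>M. card {z \<in> abs_pts. perp p z})"
    by (intro sum.cong refl) (simp add: sum.If_cases Int_def)
  also have "\<dots> \<le> (\<Sum>p\<in>M. q + 1)"
    using M_abs card_perp_abs_pts_le by (intro sum_mono) (auto simp: M_def)
  finally have upper: "(\<Sum>z\<in>abs_pts. card {p \<in> M. perp p z}) \<le> k * (q + 1)"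
    by (simp add: k_def)
  have "abs_pts = (abs_pts \<inter> line \<alpha> \<beta>) \<union> (abs_pts - line \<alpha> \<beta>)"
    by blast
  then have "(\<Sum>z\<in>abs_pts. card {p \<in> M. perp p z})
      = (\<Sum>z\<in>abs_pts \<inter> line \<alpha> \<beta>. card {p \<in> M. perp p z}) + (\<Sum>z\<in>abs_pts - line \<alpha> \<beta>. card {p \<in> M. perp p z})"
    by (metis (no_types, lifting) finite sum.Int_Diff)
  moreover have "(\<Sum>z\<in>abs_pts \<inter> line \<alpha> \<beta>. card {p \<in> M. perp p z}) = c * k"
    using count1 by (simp add: c_def)
  moreover have "(\<Sum>z\<in>abs_pts - line \<alpha> \<beta>. card {p \<in> M. perp p z}) \<ge> card (abs_pts - line \<alpha> \<beta>)"
    using count2 sum_mono[of "abs_pts - line \<alpha> \<beta>" "\<lambda>_. 1" "\<lambda>z. card {p \<in> M. perp p z}"] by simp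
  moreover have "card (abs_pts - line \<alpha> \<beta>) + c = q ^ 2 + 1"
    unfolding c_def assms[symmetric] by (metis add.commute card_Int_Diff finite)
  ultimately have ineq: "c * k + (q ^ 2 + 1) \<le> k * (q + 1) + c"
    using upper by linarith
  \<comment> \<open>The inequality amounts to \<open>(c - 1) * (k - 1) + q ^ 2 \<le> k * q\<close>.
    As \<open>c \<ge> 3\<close>, it fails for \<open>k = q + 1\<close>; for \<open>k \<le> q\<close>
    it forces \<open>k = 1\<close>, and then \<open>q ^ 2 \<le> q\<close>, which is false.\<close>
  obtain d where d: "k = d + 1"
    using k1 by (metis add.commute le_Suc_ex)
  obtain j where j: "c = j + 3"
    using c3 by (metis add.commute le_Suc_ex)
  have ineq': "j * d + 2 * d + q * q \<le> q * d + q"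
    using ineq unfolding d j by (simp add: algebra_simps power2_eq_square)
  show False
  proof (cases "d = q")
    case True
    then show False
      using ineq' q_ge_2 by simp
  next
    case False
    then have "q * (d + 1) \<le> q * q"
      using kq d by (intro mult_le_mono2) simp
    then have "d = 0"
      using ineq' by simp
    moreover have "2 * q \<le> q * q"
      using q_ge_2 by simp
    ultimately show False
      using ineq' q_ge_2 by simp
  qed
qed

section \<open>Parametrization of the absolute points\<close>

text \<open>\<open>F\<close> inverts \<open>a\<close>, and \<open>F \<circ> F\<close> inverts
  \<open>u\<close> and \<open>v\<close>. The coefficient of the line is then the square of
  \<open>u1 / v1 * (A + 1)\<close>; after taking roots both sides share the factor
  \<open>u * u1 * v / v1\<close>, so \<open>u\<close> drops out.\<close>

lemma abs_pts_iff:
  assumes a: "a * F a = 1" and u: "u * F (F u) = 1" "phi u = u * F u"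
    and v: "v * F (F v) = 1" "phi v * (v * F v) = 1"
  shows "a * u * v \<in> abs_pts \<longleftrightarrow> F v * F v + phi a / (v * v) = (phi a + 1) * a"
proof -
  define u1 v1 A where d: "u1 = F u" "v1 = F v" "A = phi a"
  have nz: "a \<noteq> 0" "u \<noteq> 0" "v \<noteq> 0" "u1 \<noteq> 0" "v1 \<noteq> 0" "A \<noteq> 0"
    using assms by (auto simp: d)
  have "phi a * F (phi a) = 1"
    using a by (metis phi_F phi_mult phi_1)
  then have Fs: "F a = 1 / a" "F A = 1 / A" "F u = u1" "F u1 = 1 / u" "F v = v1" "F v1 = 1 / v"
    using a u v nz by (simp_all add: d field_simps)
  have ph: "phi u = u * u1" "phi v = 1 / (v * v1)" "phi a = A"
    using u v nz by (simp_all add: d field_simps)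
  define x X where "x = a * u * v" "X = phi x"
  have X: "X = A * (u * u1) / (v * v1)"
    by (simp add: x_X_def phi_mult ph)
  have X1: "F X = u1 * v / (A * u * v1)"
    unfolding X F_mult F_divide Fs using nz by (simp add: field_simps)
  have X2: "F (F X) = A * v * v1 / (u * u1)"
    unfolding X1 F_mult F_divide Fs using nz by (simp add: field_simps)
  have x1: "F x = u1 * v1 / a"
    unfolding x_X_def F_mult F_divide Fs using nz by (simp add: field_simps)
  have x2: "F (F x) = a / (u * v)"
    unfolding x1 F_mult F_divide Fs using nz by (simp add: field_simps)
  have x3: "F (F (F x)) = 1 / (a * u1 * v1)"
    unfolding x2 F_mult F_divide Fs using nz by (simp add: field_simps)
  have pts: "x \<in> pts"
    unfolding pts_def mem_Collect_eq unfolding x3 unfolding x2 unfolding x1 unfolding x_X_def using nz by simp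
  have "X * X * F X * F (F X) + X * F X = (u1 / v1 * (A + 1)) * (u1 / v1 * (A + 1))"
    unfolding X2 unfolding X1 unfolding X using nz
    by (simp add: divide_simps) (simp add: char2_simps)
  then have "x \<in> abs_pts \<longleftrightarrow> (x * F x + X) * (x * F x + X)
      = (u1 / v1 * (A + 1) * x) * (u1 / v1 * (A + 1) * x)"
    using pts by (simp add: abs_pts_def iso_line_def mult_ac flip: x_X_def(2))
  also have "\<dots> \<longleftrightarrow> x * F x + X = u1 / v1 * (A + 1) * x"
    by (rule square_inject)
  also have "x * F x + X = (u * u1 * v / v1) * (v1 * v1 + A / (v * v))"
    unfolding x1 X unfolding x_X_def using nz by (simp add: field_simps)
  also have "u1 / v1 * (A + 1) * x = (u * u1 * v / v1) * ((A + 1) * a)"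
    unfolding x_X_def using nz by (simp add: field_simps)
  finally show ?thesis
    using nz by (simp add: x_X_def d)
qed

text \<open>Either the factor \<open>phi a + 1\<close> cancels or \<open>phi a = 1\<close>, and both
  give \<open>a = 1\<close>. This treats \<open>v = 1\<close> in \<open>abs_pts_iff\<close>.\<close>

lemma abs_pts_condition_1:
  assumes "a * F a = 1"
  shows "1 + phi a = (phi a + 1) * a \<longleftrightarrow> a = 1"
proof
  assume "1 + phi a = (phi a + 1) * a"
  then have "(phi a + 1) * a = (phi a + 1) * 1"
    by (simp add: add.commute)
  then have "a = 1 \<or> phi a = 1"
    by (metis add_eq_0 mult_cancel_left)
  then show "a = 1"
    using phi_inject phi_1 by metis
qed (simp add: phi_1)

definition coef :: "'a \<Rightarrow> 'a" where
  "coef v = (v ^ (q - 1) + inverse (v ^ (q - 1))) ^ (q - 1)"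

lemma power_q_minus_1: "x ^ (q - 1) = F x / x"
proof (cases "x = 0")
  case False
  then show ?thesis
    using q_ge_2 power_diff[of x 1 q] by (simp add: F_power)
qed (use q_ge_2 in \<open>simp add: power_0_left\<close>)

context
  fixes v w :: 'a
  assumes v: "v * F (F v) = 1" "phi v * (v * F v) = 1" "v \<noteq> 1"
  defines "w \<equiv> F v / v + v / F v"
begin

lemma v_nonzero: "v \<noteq> 0" "F v \<noteq> 0"
  using v by auto

lemma F_F_v: "F (F v) = 1 / v"
  using v v_nonzero by (simp add: field_simps)

lemma phi_v: "phi v = 1 / (v * F v)"
  using v v_nonzero by (simp add: field_simps)

lemma F_w: "F w = 1 / (v * F v) + v * F v"
  unfolding w_def F_add F_divide F_F_v using v_nonzero by (simp add: field_simps)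

lemma F_F_w: "F (F w) = w"
  unfolding F_w F_add F_divide F_mult F_F_v w_def using v_nonzero by (simp add: field_simps)

text \<open>If \<open>w = 0\<close> then \<open>F v = v\<close>, and \<open>v * F (F v) = 1\<close>
  forces \<open>v = 1\<close>.\<close>

lemma w_nonzero: "w \<noteq> 0"
proof
  assume "w = 0"
  then have "F v * F v = v * v"
    using v_nonzero by (simp add: w_def add_eq_0 field_simps)
  then have "F v = v"
    by (simp only: square_inject)
  then have "v * v = 1 * 1"
    using v by simp
  then show False
    using v by (simp only: square_inject)
qed

lemma phi_w: "phi w = v * v + 1 / (v * v)"
proof -
  have "phi (F v) = v / F v"
    unfolding phi_F phi_v F_divide F_mult F_F_v using v_nonzero by simp
  then show ?thesis
    unfolding w_def phi_add phi_divide using v_nonzero by (simp add: phi_v field_simps)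
qed

lemma F_phi_w: "F (phi w) = F v * F v + 1 / (F v * F v)"
  by (simp add: phi_w F_add F_divide F_mult)

lemma coef_eq: "coef v = F w / w"
  unfolding coef_def power_q_minus_1 w_def by (simp add: inverse_eq_divide)

lemma coef_norm: "coef v * F (coef v) = 1"
  using w_nonzero by (simp add: coef_eq F_divide F_F_w)

lemma abs_pts_condition:
  assumes a: "a * F a = 1"
  shows "F v * F v + phi a / (v * v) = (phi a + 1) * a \<longleftrightarrow> a = coef v"
proof
  assume eq: "F v * F v + phi a / (v * v) = (phi a + 1) * a"
  have "phi a * F (phi a) = 1"
    using a by (metis phi_F phi_mult phi_1)
  moreover have "a \<noteq> 0"
    using a by auto
  ultimately have Fs: "F a = 1 / a" "F (phi a) = 1 / phi a"
    using a by (simp_all add: field_simps)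
  \<comment> \<open>\<open>F \<circ> F\<close> inverts \<open>v\<close> and fixes \<open>a\<close>,
    so the right side is unchanged; it cancels when both equations are added.\<close>
  have "F (F (F v * F v + phi a / (v * v))) = F (F ((phi a + 1) * a))"
    by (simp add: eq)
  then have eq': "1 / (F v * F v) + phi a * (v * v) = (phi a + 1) * a"
    by (simp add: F_add F_mult F_divide F_F_v Fs)
  have "(F v * F v + 1 / (F v * F v)) + phi a * (v * v + 1 / (v * v))
      = (F v * F v + phi a / (v * v)) + (1 / (F v * F v) + phi a * (v * v))"
    by (simp add: algebra_simps)
  also have "\<dots> = 0"
    unfolding eq eq' by (rule add_self)
  finally have "(F v * F v + 1 / (F v * F v)) + phi a * (v * v + 1 / (v * v)) = 0" .
  then have "F (phi w) = phi a * phi w"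
    unfolding F_phi_w unfolding phi_w by (simp add: add_eq_0)
  then have "phi a = phi (F w / w)"
    using w_nonzero by (simp add: phi_divide phi_F)
  then show "a = coef v"
    by (simp add: phi_inject coef_eq)
next
  assume a_eq: "a = coef v"
  define D where "D = phi w"
  have D: "D \<noteq> 0" "phi a = F D / D"
    using w_nonzero by (simp_all add: D_def a_eq coef_eq phi_divide phi_F)
  \<comment> \<open>After multiplication by \<open>D = phi w\<close> both sides of the condition
    equal \<open>F w * F w\<close>.\<close>
  have "(F v * F v + phi a / (v * v)) * D = F v * F v * D + F D / (v * v)"
    using D by (simp add: distrib_right)
  also have "\<dots> = F w * F w"
    unfolding D_def unfolding F_phi_w F_w unfolding phi_w using v_nonzero by (simp add: divide_simps) (simp add: char2_simps)
  also have "\<dots> = (w * F w) * a"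
    using w_nonzero by (simp add: a_eq coef_eq)
  also have "w * F w = F D + D"
    unfolding D_def unfolding F_phi_w F_w unfolding phi_w unfolding w_def using v_nonzero by (simp add: divide_simps) (simp add: char2_simps)
  also have "(F D + D) * a = ((phi a + 1) * a) * D"
    using D by (simp add: field_simps)
  finally show "F v * F v + phi a / (v * v) = (phi a + 1) * a"
    using D by simp
qed

end

section \<open>Torsion decomposition and the number of absolute points\<close>

lemma pts_iff_power: "x \<in> pts \<longleftrightarrow> x ^ ((q + 1) * (q ^ 2 + 1)) = 1"
proof -
  have "(q + 1) * (q ^ 2 + 1) = 1 + q + q * q + q * q * q"
    by (simp add: algebra_simps power2_eq_square)
  then show ?thesis
    unfolding pts_def by (simp add: F_power power_add mult_ac flip: power_mult)
qed

text \<open>A common divisor divides \<open>(q + 1) * (q + 1) - (q ^ 2 + 1) = 2 * q\<close>, hence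
  divides 2, and it is odd.\<close>

lemma coprime_factors:
  assumes "even q"
  shows "coprime (q + 1) (q ^ 2 + 1)"
proof (rule coprimeI)
  fix d assume d: "d dvd q + 1" "d dvd q ^ 2 + 1"
  then have "d dvd (q + 1) * (q + 1) - (q ^ 2 + 1)"
    by (intro dvd_diff_nat dvd_mult) auto
  also have "(q + 1) * (q + 1) - (q ^ 2 + 1) = 2 * q"
    by (simp add: algebra_simps power2_eq_square)
  finally have "d dvd 2 * (q + 1) - 2 * q"
    using dvd_mult[OF d(1), of 2] dvd_diff_nat by blast
  then have "d dvd 2"
    by simp
  moreover have "odd d"
    using d(1) assms by (meson dvd_trans even_plus_one_iff)
  ultimately show "d dvd 1"
    by (metis coprime_absorb_left coprime_commute coprime_left_2_iff_odd)
qed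

text \<open>The pair \<open>e\<close>, \<open>f\<close> is \<open>s\<close>, \<open>t\<close> for
  the first polarity and \<open>t\<close>, \<open>s\<close> for the second.\<close>

context
  fixes e f :: nat
  assumes even_q: "even q" and ef: "e * f = q ^ 2 + 1" and cop: "coprime e f"
    and phi_e: "\<forall>u. u ^ e = 1 \<longrightarrow> phi u = u * F u"
    and phi_f: "\<forall>v. v ^ f = 1 \<longrightarrow> phi v * (v * F v) = 1"
begin

lemma ef_pos: "e > 0" "f > 0"
  using ef by (auto intro: gr0I)

lemma ef_norm: "x ^ e = 1 \<or> x ^ f = 1 \<Longrightarrow> x * F (F x) = 1"
proof -
  assume "x ^ e = 1 \<or> x ^ f = 1"
  then have "x ^ (q ^ 2 + 1) = 1"
    by (metis ef power_mult mult.commute power_one)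
  then show ?thesis
    by (simp add: F_power power2_eq_square flip: power_mult)
qed

text \<open>At \<open>v = 1\<close> the formula \<open>coef\<close> yields 0 in characteristic 2,
  whereas the factor that gives an absolute point is 1.\<close>

definition coef1 :: "'a \<Rightarrow> 'a" where "coef1 v = (if v = 1 then 1 else coef v)"

lemma coef1_norm: "v ^ f = 1 \<Longrightarrow> coef1 v * F (coef1 v) = 1"
  using coef_norm[of v] ef_norm[of v] phi_f by (simp add: coef1_def)

lemma abs_pts_iff_coef1:
  assumes "a * F a = 1" "u ^ e = 1" "v ^ f = 1"
  shows "a * u * v \<in> abs_pts \<longleftrightarrow> a = coef1 v"
proof -
  have "a * u * v \<in> abs_pts \<longleftrightarrow> F v * F v + phi a / (v * v) = (phi a + 1) * a"
    using assms ef_norm phi_e phi_f by (intro abs_pts_iff) auto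
  also have "\<dots> \<longleftrightarrow> a = coef1 v"
    using abs_pts_condition[of v a] abs_pts_condition_1[of a] ef_norm[of v] phi_f assms
    by (simp add: coef1_def)
  finally show ?thesis .
qed

text \<open>The order of a point divides a product of the pairwise coprime numbers
  \<open>q + 1\<close>, \<open>e\<close>, \<open>f\<close>, so the point splits as
  \<open>a * u * v\<close>; being absolute then fixes \<open>a\<close>.\<close>

lemma abs_pts_eq: "abs_pts = (\<lambda>(u, v). coef1 v * u * v) ` ({u. u ^ e = 1} \<times> {v. v ^ f = 1})"
proof (intro equalityI subsetI)
  fix x assume x: "x \<in> abs_pts"
  then have "x ^ ((q + 1) * (q ^ 2 + 1)) = 1"
    using abs_pts_subset pts_iff_power by blast
  then obtain a z where a: "a ^ (q + 1) = 1" and z: "z ^ (q ^ 2 + 1) = 1" "x = a * z"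
    using coprime_factors[OF even_q] by (elim torsion_decompose) auto
  obtain u v where uv: "u ^ e = 1" "v ^ f = 1" "z = u * v"
    using z(1) ef_pos cop unfolding ef[symmetric] by (elim torsion_decompose) auto
  have "a * F a = 1"
    using a by (simp add: F_power)
  then have "a = coef1 v"
    using abs_pts_iff_coef1[of a u v] uv x z(2) by (simp add: mult.assoc)
  then have "x = (\<lambda>(u, v). coef1 v * u * v) (u, v)"
    by (simp add: z(2) uv(3) mult.assoc)
  then show "x \<in> (\<lambda>(u, v). coef1 v * u * v) ` ({u. u ^ e = 1} \<times> {v. v ^ f = 1})"
    using uv by blast
next
  fix x assume "x \<in> (\<lambda>(u, v). coef1 v * u * v) ` ({u. u ^ e = 1} \<times> {v. v ^ f = 1})"
  then show "x \<in> abs_pts"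
    using abs_pts_iff_coef1 coef1_norm by auto
qed

text \<open>The order of \<open>coef1 v\<close> divides \<open>q + 1\<close>, so uniqueness of the
  torsion decomposition recovers \<open>u * v\<close> from the point, and then \<open>u\<close> and
  \<open>v\<close>.\<close>

lemma card_abs_pts: "card abs_pts = q ^ 2 + 1"
proof -
  have "inj_on (\<lambda>(u, v). coef1 v * u * v) ({u. u ^ e = 1} \<times> {v. v ^ f = 1})"
  proof (rule inj_onI, clarsimp)
    fix u v u' v' assume h: "u ^ e = 1" "v ^ f = 1" "u' ^ e = 1" "v' ^ f = 1"
      "coef1 v * u * v = coef1 v' * u' * v'"
    have n: "z ^ (q ^ 2 + 1) = 1" if "z = x * y" "x ^ e = 1" "y ^ f = 1" for x y z :: 'a
      using that unfolding ef[symmetric] power_mult_distrib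
      by (metis mult.commute mult_1 power_mult power_mult_distrib power_one)
    have c: "coef1 v ^ (q + 1) = 1" "coef1 v' ^ (q + 1) = 1"
      using coef1_norm h by (simp_all add: F_power)
    have "u * v = u' * v'"
      using torsion_product_unique(2)[OF c n n coprime_factors[OF even_q], of "u * v" u v "u' * v'" u' v'] h
      by (simp add: mult.assoc)
    then show "u = u' \<and> v = v'"
      using torsion_product_unique[OF h(1,3,2,4) cop] ef_pos by blast
  qed
  then have "card abs_pts = card {u :: 'a. u ^ e = 1} * card {v :: 'a. v ^ f = 1}"
    unfolding abs_pts_eq by (simp add: card_image card_cartesian_product)
  moreover have "int (q ^ 4 - 1) = int ((q ^ 2 + 1) * (q ^ 2 - 1))"
    using q_ge_2 by (simp add: of_nat_diff algebra_simps flip: power_add)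
  then have "e * f dvd card (UNIV :: 'a set) - 1"
    unfolding ef card_UNIV by (metis dvd_triv_left of_nat_eq_iff)
  then have "card {u :: 'a. u ^ e = 1} = e" "card {v :: 'a. v ^ f = 1} = f"
    by (auto intro!: card_torsion dest: dvd_mult_left dvd_mult_right)
  ultimately show ?thesis
    by (simp add: ef)
qed

lemma abs_pts_eq_Un:
  "abs_pts = {u. u ^ e = 1} \<union>
     {(v ^ (q - 1) + inverse (v ^ (q - 1))) ^ (q - 1) * u * v | u v. u ^ e = 1 \<and> v ^ f = 1 \<and> v \<noteq> 1}"
  (is "_ = ?A \<union> ?B")
proof (intro equalityI subsetI)
  fix x assume "x \<in> abs_pts"
  then obtain u v where "u ^ e = 1" "v ^ f = 1" "x = coef1 v * u * v"
    unfolding abs_pts_eq by auto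
  then show "x \<in> ?A \<union> ?B"
    by (cases "v = 1") (auto simp: coef1_def coef_def)
next
  fix x assume "x \<in> ?A \<union> ?B"
  then obtain u v where uv: "u ^ e = 1" "v ^ f = 1" "x = coef1 v * u * v"
  proof
    assume "x \<in> ?A"
    then show thesis
      using that[of x 1] by (simp add: coef1_def)
  next
    assume "x \<in> ?B"
    then obtain u v where "x = coef v * u * v" "u ^ e = 1" "v ^ f = 1" "v \<noteq> 1"
      unfolding coef_def by blast
    then show thesis
      using that[of u v] by (simp add: coef1_def)
  qed
  then show "x \<in> abs_pts"
    unfolding abs_pts_eq by (auto intro!: rev_image_eqI[of "(u, v)"])
qed

end

section \<open>Translation to the given definitions\<close>

lemma Pts_eq_pts: "q = qq m \<Longrightarrow> Pts m = pts"
  unfolding Pts_def pts_def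
  by (simp add: F_power power_add mult_ac flip: power_mult) (simp add: numeral_eq_Suc mult_ac)

lemma sqrt2_square: "sqrt2 x * sqrt2 x = (x::'a)"
proof -
  obtain y where y: "y * y = x"
    using sqrt_exists by blast
  then have "sqrt2 x = y"
    unfolding sqrt2_def power2_eq_square by (intro the_equality) (auto simp: square_inject)
  then show ?thesis
    using y by simp
qed

lemma Lw_eq_iso_line:
  assumes "q = qq m" "even q"
  shows "Lw m \<beta> = iso_line \<beta>"
proof -
  define \<gamma> where "\<gamma> = \<beta> ^ ((q ^ 2 + q + 2) div 2) + sqrt2 (\<beta> ^ (q + 1))"
  have "\<gamma> * \<gamma> = \<beta> ^ ((q ^ 2 + q + 2) div 2) * \<beta> ^ ((q ^ 2 + q + 2) div 2) + \<beta> ^ (q + 1)"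
    unfolding \<gamma>_def by (simp add: char2_simps sqrt2_square)
  also have "\<beta> ^ ((q ^ 2 + q + 2) div 2) * \<beta> ^ ((q ^ 2 + q + 2) div 2) = \<beta> ^ (q ^ 2 + q + 2)"
    using assms(2) by (simp flip: power_add mult_2)
  finally have g: "\<gamma> * \<gamma> = \<beta> * \<beta> * F \<beta> * F (F \<beta>) + \<beta> * F \<beta>"
    by (simp add: F_power power_add power2_eq_square mult_ac flip: power_mult)
  have "x * F x + \<gamma> * x + \<beta> = 0 \<longleftrightarrow>
      (x * F x + \<beta>) * (x * F x + \<beta>) = (\<gamma> * \<gamma>) * (x * x)" for x
    using add_eq_0[of "x * F x + \<beta>" "\<gamma> * x"] square_inject[of "x * F x + \<beta>" "\<gamma> * x"]
    by (simp add: ac_simps)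
  then show ?thesis
    unfolding Lw_def iso_line_def g[symmetric] Pts_eq_pts[OF assms(1)]
    by (simp add: F_power \<gamma>_def flip: assms(1))
qed

lemma PG_lines_subset: "q = qq m \<Longrightarrow> l \<in> PG_lines m \<Longrightarrow> \<exists>\<alpha> \<beta>. l = line \<alpha> \<beta>"
  by (auto simp: PG_lines_def line_def Pts_eq_pts F_power)

end

theorem theorem4p3:
  fixes m :: nat
  assumes "odd m" and "m \<ge> 3"
    and "card (UNIV :: 'a::{finite,field} set) = qq m ^ 4"
  shows "(T0 m :: 'a set) = {x \<in> Pts m. x \<in> Lw m (x ^ sq2q m)}
       \<and> (T1 m :: 'a set) = {x \<in> Pts m. x \<in> Lw m (x ^ (qq m ^ 2 * sq2q m))}
       \<and> card (T0 m :: 'a set) = qq m ^ 2 + 1 \<and> (\<forall>l \<in> (PG_lines m :: 'a set set). card (T0 m \<inter> l) \<le> 2)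
       \<and> card (T1 m :: 'a set) = qq m ^ 2 + 1 \<and> (\<forall>l \<in> (PG_lines m :: 'a set set). card (T1 m \<inter> l) \<le> 2)"
proof -
  define q r where "q = qq m" and "r = sq2q m"
  obtain h where m: "m = 2 * h + 1"
    using assms(1) by (auto elim: oddE)
  have r: "r = 2 ^ (h + 1)" and q: "q = 2 ^ (2 * h + 1)"
    by (simp_all add: q_def r_def qq_def sq2q_def m)
  have rr: "r * r = 2 * q"
    unfolding r q by (simp flip: power_add power_Suc)
  \<comment> \<open>As a power of two, this exponent gives an additive map.\<close>
  have qq: "q ^ 2 * r = 2 ^ (2 * (2 * h + 1) + (h + 1))"
    unfolding r q power_mult[symmetric] power_add[symmetric] by (simp add: mult.commute)
  have card: "card (UNIV :: 'a set) = q ^ 4"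
    using assms(3) by (simp add: q_def)
  have two: "(1::'a) + 1 = 0"
    by (rule char2_of_card[of "(2 * h + 1) * 4"]) (simp add: card q power_add flip: power_mult)
  have q2: "q \<ge> 2" and "even q"
    by (simp_all add: q)
  have q4: "x ^ (q ^ 4) = x" for x :: 'a
  proof (cases "x = 0")
    case False
    have "x ^ (q ^ 4) = x * x ^ (q ^ 4 - 1)"
      using q2 by (simp flip: power_Suc)
    then show ?thesis
      using power_card_minus_1_eq_1[OF False] by (simp add: card)
  qed (use q2 in \<open>simp add: power_0_left\<close>)
  have frob: "(x + y) ^ q = x ^ q + y ^ q" "(x + y) ^ r = x ^ r + y ^ r"
    "(x + y) ^ (q ^ 2 * r) = x ^ (q ^ 2 * r) + y ^ (q ^ 2 * r)" for x y :: 'a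
    unfolding qq unfolding q r by (rule frobenius_add[OF two])+
  have "((((x::'a) ^ q) ^ q) ^ q) ^ q = x ^ (q ^ 4)" for x
    by (simp add: eval_nat_numeral mult_ac flip: power_mult)
  then have F4: "((((x::'a) ^ q) ^ q) ^ q) ^ q = x" for x
    by (simp add: q4)
  have phi0: "((x::'a) ^ r) ^ r = x ^ q * x ^ q" for x
    by (simp add: rr flip: power_mult power_add) (simp add: mult_2)
  \<comment> \<open>The power \<open>q ^ 4\<close> acts trivially, so both choices of
    \<open>phi\<close> have the same square.\<close>
  have "((x::'a) ^ (q ^ 2 * r)) ^ (q ^ 2 * r) = (x ^ (q ^ 4)) ^ (r * r)" for x
    by (simp add: eval_nat_numeral mult_ac flip: power_mult)
  then have phi1: "((x::'a) ^ (q ^ 2 * r)) ^ (q ^ 2 * r) = x ^ q * x ^ q" for x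
    by (simp only: q4) (simp add: phi0 power_mult)
  have comm: "((x::'a) ^ i) ^ j = (x ^ j) ^ i" for x i j
    by (simp add: mult.commute flip: power_mult)
  interpret P0: polar_field q "\<lambda>x::'a. x ^ q" "\<lambda>x. x ^ r"
    by (intro polar_field.intro two card q2 refl frob F4 power_mult_distrib power_one phi0 comm)
  interpret P1: polar_field q "\<lambda>x::'a. x ^ q" "\<lambda>x. x ^ (q ^ 2 * r)"
    by (intro polar_field.intro two card q2 refl frob F4 power_mult_distrib power_one phi1 comm)
  define s t where "s = s_exp m" and "t = t_exp m"
  have "r \<le> q"
    unfolding r q by (intro power_increasing) auto
  then have s: "s + r = q + 1" and t: "t = q + r + 1"
    by (simp_all add: s_def t_def s_exp_def t_exp_def q_def r_def)
  \<comment> \<open>With \<open>s = q + 1 - r\<close> and \<open>t = q + 1 + r\<close> the product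
    is \<open>(q + 1) ^ 2 - 2 * q\<close>.\<close>
  have st: "s * t = q ^ 2 + 1"
  proof -
    have int_s: "int s = int q + 1 - int r"
      using s by linarith
    have "int (s * t) = (int q + 1) * (int q + 1) - int (r * r)"
      unfolding of_nat_mult int_s by (simp add: t algebra_simps)
    also have "\<dots> = int (q ^ 2 + 1)"
      unfolding rr by (simp add: algebra_simps power2_eq_square)
    finally show ?thesis
      by (simp only: of_nat_eq_iff)
  qed
  have "odd s"
    using st \<open>even q\<close> by (metis even_mult_iff even_plus_one_iff even_power zero_less_numeral)
  have cop: "coprime s t"
  proof (rule coprimeI)
    fix d assume d: "d dvd s" "d dvd t"
    \<comment> \<open>The difference \<open>2 * r\<close> is a power of two, while \<open>s\<close>
      is odd.\<close>
    have "t - s = 2 ^ (h + 2)"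
      using s t r by simp
    then have "d dvd 2 ^ (h + 2)"
      using d dvd_diff_nat by metis
    moreover have "coprime d (2 ^ (h + 2))"
      using d(1) \<open>odd s\<close> by (meson coprime_power_right_iff coprime_right_2_iff_odd dvd_trans)
    ultimately show "d dvd 1"
      by (metis coprime_absorb_left)
  qed
  have us: "\<forall>u::'a. u ^ s = 1 \<longrightarrow> u ^ r = u * u ^ q"
  proof (intro allI impI)
    fix u :: 'a assume "u ^ s = 1"
    then show "u ^ r = u * u ^ q"
      using arg_cong[OF s, of "\<lambda>n. u ^ n"] by (simp add: power_add)
  qed
  have ut: "\<forall>u::'a. u ^ t = 1 \<longrightarrow> u ^ r * (u * u ^ q) = 1"
    by (simp add: t power_add mult_ac)
  \<comment> \<open>The power \<open>q ^ 2\<close> inverts elements of order dividing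
    \<open>q ^ 2 + 1\<close>. So the second \<open>phi\<close> takes inverse values there, which
    exchanges the roles of \<open>s\<close> and \<open>t\<close>.\<close>
  have ust: "u ^ (q ^ 2 * r) * u ^ r = 1" if "u ^ s = 1 \<or> u ^ t = 1" for u :: 'a
  proof -
    have "u ^ (q ^ 2 * r) * u ^ r = (u ^ (q ^ 2 + 1)) ^ r"
      by (simp add: power_add power_mult power_mult_distrib)
    also have "u ^ (q ^ 2 + 1) = 1"
      using that unfolding st[symmetric] by (metis mult.commute power_mult power_one)
    finally show ?thesis
      by simp
  qed
  have ut': "\<forall>u::'a. u ^ t = 1 \<longrightarrow> u ^ (q ^ 2 * r) = u * u ^ q"
    using ust ut by (metis mult.commute mult_right_cancel mult_zero_left zero_neq_one)
  have us': "\<forall>u::'a. u ^ s = 1 \<longrightarrow> u ^ (q ^ 2 * r) * (u * u ^ q) = 1"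
    using ust us by metis
  have ts: "t * s = q ^ 2 + 1" "coprime t s"
    using st cop by (simp_all add: mult.commute coprime_commute)
  have T0: "T0 m = P0.abs_pts"
    unfolding P0.abs_pts_eq_Un[OF \<open>even q\<close> st cop us ut] T0_def Os_def Ot_def
    by (simp flip: s_def t_def q_def)
  \<comment> \<open>In \<open>T1\<close> the coefficient depends on the first factor; renaming
    brings it to the form of \<open>abs_pts_eq_Un\<close>.\<close>
  have swap: "{c u * u * v | u v. u \<in> A - {1} \<and> v \<in> B} = {c v * u * v | u v. u \<in> B \<and> v \<in> A \<and> v \<noteq> 1}"
    for c :: "'a \<Rightarrow> 'a" and A B
    by (rule Collect_cong, subst ex_comm) (simp add: mult_ac conj_ac)
  have T1: "T1 m = P1.abs_pts"
    unfolding P1.abs_pts_eq_Un[OF \<open>even q\<close> ts ut' us'] T1_def swap Os_def Ot_def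
    by (simp flip: s_def t_def q_def)
  have 1: "(T0 m :: 'a set) = {x \<in> Pts m. x \<in> Lw m (x ^ r)}"
    unfolding T0 P0.abs_pts_def P0.Lw_eq_iso_line[OF q_def \<open>even q\<close>] P0.Pts_eq_pts[OF q_def] by (rule refl)
  have 2: "(T1 m :: 'a set) = {x \<in> Pts m. x \<in> Lw m (x ^ (q ^ 2 * r))}"
    unfolding T1 P1.abs_pts_def P1.Lw_eq_iso_line[OF q_def \<open>even q\<close>] P1.Pts_eq_pts[OF q_def] by (rule refl)
  have 3: "card (T0 m :: 'a set) = q ^ 2 + 1"
    unfolding T0 using P0.card_abs_pts[OF \<open>even q\<close> st cop us ut] .
  have 4: "card (T1 m :: 'a set) = q ^ 2 + 1"
    unfolding T1 using P1.card_abs_pts[OF \<open>even q\<close> ts ut' us'] .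
  have 5: "card (T0 m \<inter> l) \<le> 2" if "l \<in> PG_lines m" for l :: "'a set"
    using P0.PG_lines_subset[OF q_def that] P0.card_abs_pts_line_le 3 unfolding T0 by metis
  have 6: "card (T1 m \<inter> l) \<le> 2" if "l \<in> PG_lines m" for l :: "'a set"
    using P1.PG_lines_subset[OF q_def that] P1.card_abs_pts_line_le 4 unfolding T1 by metis
  show ?thesis
    using 1 2 3 4 5 6 unfolding q_def r_def by (intro conjI ballI)
qed
end
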